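(* Let $b_k$ denote the number of complete non-ambiguous trees with $k$ internal vertices. Then, as formal power series in $x$, $$\sum_{k\ge 0} b_k\,\frac{x^{2(k+1)}}{\big((k+1)!\,2^{k+1}\big)^2}=-\ln\big(J_0(x)\big),$$ where $J_0$ is the Bessel function of order $0$.
   Context: The Bessel function is $J_0(x)=\sum_{m\ge0}\frac{(-1)^m}{(m!)^2}\left(\frac{x}{2}\right)^{2m}$. $\mathbb{N}=\{0,1,2,\dots\}$. For a point $p\in\mathbb{N}\times\mathbb{N}$ write $p=(X(p),Y(p))$. A row is a set of points with fixed $X$, a column a set of points with fixed $Y$. A non-ambiguous tree of size $n$ is a set $A$ of $n$ points of $\mathbb{N}\times\mathbb{N}$ such that: (1) $(0,0)\in A$ (the root); (2) for each non-root $p\in A$, exactly one of the following holds: there is $q\in A$ with $X(q)=X(p)$, $Y(q)<Y(p)$; there is $r\in A$ with $Y(r)=Y(p)$, $X(r)<X(p)$; (3) if some $p\in A$ has $X(p)=x$ (resp. $Y(p)=y$), then for every $0\le x'<x$ (resp. $0\le y'<y$) some $q\in A$ has $X(q)=x'$ (resp. $Y(q)=y'$). $A$ has a binary tree structure with root $(0,0)$: the parent of a non-root $p$ is the nearest point of $A$ preceding $p$ in its row (then $p$ is a right child) or in its column (then $p$ is a left child). A non-ambiguous tree is complete if each of its vertices has either $0$ or $2$ children; vertices with $2$ children are internal. *)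

theory Defs
  imports "HOL-Computational_Algebra.Formal_Power_Series"
begin

text \<open>
  A point \<open>p\<close> has coordinates \<open>X(p) = fst p\<close> and \<open>Y(p) = snd p\<close>; a row has fixed \<open>fst\<close>, a column
  fixed \<open>snd\<close>. The size of a non-ambiguous tree \<open>A\<close> is \<open>card A\<close>.
\<close>

definition non_ambiguous_tree :: "(nat \<times> nat) set \<Rightarrow> bool" where
  "non_ambiguous_tree A \<longleftrightarrow>
     finite A \<and>
     (0, 0) \<in> A \<and>
     (\<forall>p\<in>A. p \<noteq> (0, 0) \<longrightarrow>
        ((\<exists>q\<in>A. fst q = fst p \<and> snd q < snd p) \<noteq>
         (\<exists>r\<in>A. snd r = snd p \<and> fst r < fst p))) \<and>
     (\<forall>p\<in>A. \<forall>x'<fst p. \<exists>q\<in>A. fst q = x') \<and>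
     (\<forall>p\<in>A. \<forall>y'<snd p. \<exists>q\<in>A. snd q = y')"

definition right_child :: "(nat \<times> nat) set \<Rightarrow> nat \<times> nat \<Rightarrow> nat \<times> nat \<Rightarrow> bool" where
  "right_child A q p \<longleftrightarrow>
     q \<in> A \<and> p \<in> A \<and> fst q = fst p \<and> snd q < snd p \<and>
     \<not> (\<exists>r\<in>A. fst r = fst p \<and> snd q < snd r \<and> snd r < snd p)"

definition left_child :: "(nat \<times> nat) set \<Rightarrow> nat \<times> nat \<Rightarrow> nat \<times> nat \<Rightarrow> bool" where
  "left_child A q p \<longleftrightarrow>
     q \<in> A \<and> p \<in> A \<and> snd q = snd p \<and> fst q < fst p \<and>
     \<not> (\<exists>r\<in>A. snd r = snd p \<and> fst q < fst r \<and> fst r < fst p)"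

text \<open>\<open>right_child A q p\<close> and \<open>left_child A q p\<close> mean that \<open>p\<close> is a child of \<open>q\<close>, i.e. \<open>q\<close> is the parent.\<close>

definition children :: "(nat \<times> nat) set \<Rightarrow> nat \<times> nat \<Rightarrow> (nat \<times> nat) set" where
  "children A q = {p. right_child A q p \<or> left_child A q p}"

definition complete_non_ambiguous_tree :: "(nat \<times> nat) set \<Rightarrow> bool" where
  "complete_non_ambiguous_tree A \<longleftrightarrow>
     non_ambiguous_tree A \<and> (\<forall>q\<in>A. card (children A q) = 0 \<or> card (children A q) = 2)"

definition internal_vertices :: "(nat \<times> nat) set \<Rightarrow> (nat \<times> nat) set" where
  "internal_vertices A = {q \<in> A. card (children A q) = 2}"

definition num_complete_nats :: "nat \<Rightarrow> nat" where
  "num_complete_nats k =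
     card {A. complete_non_ambiguous_tree A \<and> card (internal_vertices A) = k}"

definition fps_J0 :: "real fps" where
  "fps_J0 = Abs_fps (\<lambda>n. if even n
     then (- 1) ^ (n div 2) / (fact (n div 2))\<^sup>2 * (1 / 2) ^ n else 0)"

lemma sums_fps_J0:
  "(\<lambda>m. fps_const ((- 1) ^ m / (fact m)\<^sup>2) * (fps_const (1 / 2) * fps_X) ^ (2 * m)) sums fps_J0"
proof -
  let ?f = "\<lambda>m. fps_const ((- 1) ^ m / (fact m)\<^sup>2 :: real) * (fps_const (1 / 2) * fps_X) ^ (2 * m)"
  have f: "fps_nth (?f m) n = (if n = 2 * m then fps_nth fps_J0 n else 0)" for m n
    by (simp add: power_mult_distrib fps_const_power fps_J0_def mult.assoc
        flip: fps_const_mult)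
  have s: "fps_nth (sum ?f {..<N}) n = fps_nth fps_J0 n" if "n < N" for n N
  proof (cases "even n")
    case True
    then obtain m where "n = 2 * m" by blast
    then show ?thesis using that by (simp only: fps_sum_nth f) simp
  next
    case False
    then have "fps_nth (?f m) n = 0" for m unfolding f by auto
    then show ?thesis using False by (simp only: fps_sum_nth) (simp add: fps_J0_def)
  qed
  show ?thesis
    unfolding sums_def
    by (rule tendsto_fpsI, rule eventually_mono[OF eventually_gt_at_top]) (rule s)
qed

text \<open>
  \<open>fps_ln 1\<close> is the series of \<open>ln (1 + x)\<close>, so the logarithm of a series with constant
  coefficient 1 is obtained by composing it with the series minus 1.
\<close>

definition fps_log :: "real fps \<Rightarrow> real fps" where
  "fps_log f = fps_ln 1 oo (f - 1)"

end

theory Submission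
  imports Defs "HOL-Library.Infinite_Set"
begin

text \<open>
  Deleting the root of a complete non-ambiguous tree with \<open>k > 0\<close> internal vertices leaves the
  subtrees of its two children. They share no row and no column, the left one inherits the root's
  column and the right one the root's row, and up to relabelling rows and columns both are again
  complete non-ambiguous trees. A tree has one more row, and one more column, than internal
  vertices. Choosing the rows and columns of the left subtree gives
  \<open>b k = (\<Sum>c<k. (k choose (c + 1)) * (k choose c) * b c * b (k - 1 - c))\<close>.
  With \<open>\<theta> = x d/dx\<close> this recursion and \<open>b 0 = 1\<close> say that the series \<open>G\<close> on the left satisfies
  \<open>\<theta> (\<theta> G) = x\<^sup>2 + (\<theta> G)\<^sup>2\<close>. Bessel's equation \<open>\<theta> (\<theta> J\<^sub>0) = - x\<^sup>2 J\<^sub>0\<close> says the same of \<open>- ln J\<^sub>0\<close>,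
  and the equation determines all coefficients but the constant one.
\<close>

section \<open>Splitting a tree at its root\<close>

text \<open>The root may sit anywhere and rows or columns may be skipped, so that subtrees fit the
  definition without relabelling. As a vertex has at most one child of each kind, having 0 or 2
  children means that its row continues after it exactly when its column does.\<close>

definition complete_tree :: "nat \<Rightarrow> nat \<Rightarrow> (nat \<times> nat) set \<Rightarrow> bool" where
  "complete_tree a b A \<longleftrightarrow>
     finite A \<and> (a, b) \<in> A \<and>
     (\<forall>x y. (x, y) \<in> A \<longrightarrow> a \<le> x \<and> b \<le> y) \<and>
     (\<forall>x y. (x, y) \<in> A \<longrightarrow> (x, y) \<noteq> (a, b) \<longrightarrow>
        (\<exists>y'<y. (x, y') \<in> A) \<noteq> (\<exists>x'<x. (x', y) \<in> A)) \<and>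
     (\<forall>x y. (x, y) \<in> A \<longrightarrow> (\<exists>y'>y. (x, y') \<in> A) = (\<exists>x'>x. (x', y) \<in> A))"

lemma complete_treeD:
  assumes "complete_tree a b A"
  shows "finite A" "(a, b) \<in> A"
    "(x, y) \<in> A \<Longrightarrow> a \<le> x" "(x, y) \<in> A \<Longrightarrow> b \<le> y"
    "(x, y) \<in> A \<Longrightarrow> (x, y) \<noteq> (a, b) \<Longrightarrow> (\<exists>y'<y. (x, y') \<in> A) \<noteq> (\<exists>x'<x. (x', y) \<in> A)"
    "(x, y) \<in> A \<Longrightarrow> (\<exists>y'>y. (x, y') \<in> A) = (\<exists>x'>x. (x', y) \<in> A)"
  using assms unfolding complete_tree_def by blast+

text \<open>Steps lead to any later point of the row or column. The nearest ones would reach the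
  same points, but need not be singled out this way.\<close>

inductive_set descendants :: "(nat \<times> nat) set \<Rightarrow> (nat \<times> nat) set \<Rightarrow> (nat \<times> nat) set"
  for A B where
  base: "p \<in> B \<Longrightarrow> p \<in> descendants A B"
| row: "(x, y) \<in> descendants A B \<Longrightarrow> (x, y') \<in> A \<Longrightarrow> y < y' \<Longrightarrow> (x, y') \<in> descendants A B"
| col: "(x, y) \<in> descendants A B \<Longrightarrow> (x', y) \<in> A \<Longrightarrow> x < x' \<Longrightarrow> (x', y) \<in> descendants A B"

definition left_part :: "nat \<Rightarrow> nat \<Rightarrow> (nat \<times> nat) set \<Rightarrow> (nat \<times> nat) set" where
  "left_part a b A = descendants A {(x, b) |x. (x, b) \<in> A \<and> a < x}"

definition right_part :: "nat \<Rightarrow> nat \<Rightarrow> (nat \<times> nat) set \<Rightarrow> (nat \<times> nat) set" where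
  "right_part a b A = descendants A {(a, y) |y. (a, y) \<in> A \<and> b < y}"

text \<open>The root's row is left to \<open>E\<close> and its column to \<open>D\<close>, so
  transposing exchanges the roles of \<open>D\<close> and \<open>E\<close>.\<close>

definition split_tree ::
  "nat \<Rightarrow> nat \<Rightarrow> (nat \<times> nat) set \<Rightarrow> (nat \<times> nat) set \<Rightarrow> (nat \<times> nat) set \<Rightarrow> bool" where
  "split_tree a b A D E \<longleftrightarrow> A = insert (a, b) (D \<union> E) \<and>
     Domain D \<inter> Domain E = {} \<and> Range D \<inter> Range E = {} \<and> a \<notin> Domain D \<and> b \<notin> Range E"

lemma split_treeD:
  assumes "split_tree a b A D E"
  shows "A = insert (a, b) (D \<union> E)"
   "(x, y) \<in> D \<Longrightarrow> (x, y') \<notin> E" "(x, y) \<in> D \<Longrightarrow> (x', y) \<notin> E"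
   "(a, y) \<notin> D" "(x, b) \<notin> E"
  using assms by (auto simp: split_tree_def)

lemma descendants_subset: "B \<subseteq> A \<Longrightarrow> descendants A B \<subseteq> A"
proof -
  assume "B \<subseteq> A"
  have "p \<in> A" if "p \<in> descendants A B" for p
    using that by induction (use \<open>B \<subseteq> A\<close> in auto)
  then show ?thesis by blast
qed

text \<open>Transposition exchanges rows with columns; it transfers several facts from left subtrees
  to right ones.\<close>

lemma left_part_converse: "(left_part a b A)\<inverse> = right_part b a (A\<inverse>)"
proof -
  have 1: "(y, x) \<in> descendants (A\<inverse>) (B\<inverse>)" if "(x, y) \<in> descendants A B" for x y A B
    using that by (induction "(x, y)" arbitrary: x y) (auto intro: descendants.intros)
  have 2: "(descendants A B)\<inverse> = descendants (A\<inverse>) (B\<inverse>)" for A B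
    using 1[of _ _ A B] 1[of _ _ "A\<inverse>" "B\<inverse>"] by auto
  have "{(x, b) |x. (x, b) \<in> A \<and> a < x}\<inverse> = {(b, y) |y. (b, y) \<in> A\<inverse> \<and> a < y}" by auto
  then show ?thesis by (simp add: left_part_def right_part_def 2)
qed

lemma complete_tree_converse: "complete_tree a b A \<Longrightarrow> complete_tree b a (A\<inverse>)"
  unfolding complete_tree_def by (simp add: conj_commute) metis


lemma left_part_subset: "left_part a b A \<subseteq> A"
  unfolding left_part_def by (rule descendants_subset) auto

lemma right_part_subset: "right_part a b A \<subseteq> A"
  unfolding right_part_def by (rule descendants_subset) auto

lemma left_part_gt: "p \<in> left_part a b A \<Longrightarrow> a < fst p"
  unfolding left_part_def by (induction rule: descendants.induct) auto

lemma right_part_gt: "p \<in> right_part a b A \<Longrightarrow> b < snd p"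
  unfolding right_part_def by (induction rule: descendants.induct) auto

lemma left_part_intros:
  "(x, b) \<in> A \<Longrightarrow> a < x \<Longrightarrow> (x, b) \<in> left_part a b A"
  "(x, y) \<in> left_part a b A \<Longrightarrow> (x, y') \<in> A \<Longrightarrow> y < y' \<Longrightarrow> (x, y') \<in> left_part a b A"
  "(x, y) \<in> left_part a b A \<Longrightarrow> (x', y) \<in> A \<Longrightarrow> x < x' \<Longrightarrow> (x', y) \<in> left_part a b A"
  unfolding left_part_def by (auto intro: descendants.intros)

lemma right_part_intros:
  "(a, y) \<in> A \<Longrightarrow> b < y \<Longrightarrow> (a, y) \<in> right_part a b A"
  "(x, y) \<in> right_part a b A \<Longrightarrow> (x, y') \<in> A \<Longrightarrow> y < y' \<Longrightarrow> (x, y') \<in> right_part a b A"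
  "(x, y) \<in> right_part a b A \<Longrightarrow> (x', y) \<in> A \<Longrightarrow> x < x' \<Longrightarrow> (x', y) \<in> right_part a b A"
  unfolding right_part_def by (auto intro: descendants.intros)

lemma left_part_cases:
  assumes "(x, y) \<in> left_part a b A"
  obtains "y = b" "(x, y) \<in> A"
  | y' where "y' < y" "(x, y') \<in> left_part a b A"
  | x' where "x' < x" "(x', y) \<in> left_part a b A"
  using assms unfolding left_part_def by (cases rule: descendants.cases) auto

lemma right_part_cases:
  assumes "(x, y) \<in> right_part a b A"
  obtains "x = a" "(x, y) \<in> A"
  | y' where "y' < y" "(x, y') \<in> right_part a b A"
  | x' where "x' < x" "(x', y) \<in> right_part a b A"
  using assms unfolding right_part_def by (cases rule: descendants.cases) auto

text \<open>A non-root vertex has an earlier point in its row or column. That point is the root or,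
  by induction, lies in one of the parts, which then also contains the vertex.\<close>

lemma parts_cover:
  assumes t: "complete_tree a b A"
  shows "(x, y) \<in> A \<Longrightarrow> (x, y) \<noteq> (a, b) \<Longrightarrow> (x, y) \<in> left_part a b A \<union> right_part a b A"
proof (induction "x + y" arbitrary: x y rule: less_induct)
  case less
  consider y' where "y' < y" "(x, y') \<in> A" | x' where "x' < x" "(x', y) \<in> A"
    using complete_treeD(5)[OF t less.prems] by blast
  then show ?case
  proof cases
    case 1
    show ?thesis
    proof (cases "(x, y') = (a, b)")
      case True
      then show ?thesis using 1 less.prems right_part_intros(1)[of a y A b] by auto
    next
      case False
      then have "(x, y') \<in> left_part a b A \<union> right_part a b A" using less.hyps 1 by simp
      then show ?thesis using 1 less.prems left_part_intros(2) right_part_intros(2) by blast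
    qed
  next
    case 2
    show ?thesis
    proof (cases "(x', y) = (a, b)")
      case True
      then show ?thesis using 2 less.prems left_part_intros(1)[of x b A a] by auto
    next
      case False
      then have "(x', y) \<in> left_part a b A \<union> right_part a b A" using less.hyps 2 by simp
      then show ?thesis using 2 less.prems left_part_intros(3) right_part_intros(3) by blast
    qed
  qed
qed

text \<open>
  At a minimal common vertex, the two vertices it was reached from lie both in its row or both in
  its column, and the later of them is a smaller common vertex.
\<close>

lemma parts_disjoint:
  assumes t: "complete_tree a b A"
  shows "(x, y) \<in> left_part a b A \<Longrightarrow> (x, y) \<notin> right_part a b A"
proof (induction "x + y" arbitrary: x y rule: less_induct)
  case less
  show ?case
  proof
    assume E: "(x, y) \<in> right_part a b A"
    have xy: "a < x" "b < y" "(x, y) \<in> A"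
      using left_part_gt[OF less.prems] right_part_gt[OF E] E right_part_subset by auto
    then have one: "\<not> ((\<exists>y'<y. (x, y') \<in> A) \<and> (\<exists>x'<x. (x', y) \<in> A))"
      using complete_treeD(5)[OF t] by blast
    note sub = subsetD[OF left_part_subset] subsetD[OF right_part_subset]
    from less.prems show False
    proof (cases rule: left_part_cases)
      case 1
      then show ?thesis using xy by simp
    next
      case y1: (2 y1)
      from E show False
      proof (cases rule: right_part_cases)
        case 1
        then show ?thesis using xy by simp
      next
        case y2: (2 y2)
        consider "y1 < y2" | "y1 = y2" | "y2 < y1" by linarith
        then show False
          using less.hyps[of x y1] less.hyps[of x y2] y1 y2
            left_part_intros(2)[OF y1(2) sub(2)[OF y2(2)]]
            right_part_intros(2)[OF y2(2) sub(1)[OF y1(2)]]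
          by cases simp_all
      next
        case (3 x2)
        then show False using one y1 sub by blast
      qed
    next
      case x1: (3 x1)
      from E show False
      proof (cases rule: right_part_cases)
        case 1
        then show ?thesis using xy by simp
      next
        case (2 y2)
        then show False using one x1 sub by blast
      next
        case x2: (3 x2)
        consider "x1 < x2" | "x1 = x2" | "x2 < x1" by linarith
        then show False
          using less.hyps[of x1 y] less.hyps[of x2 y] x1 x2
            left_part_intros(3)[OF x1(2) sub(2)[OF x2(2)]]
            right_part_intros(3)[OF x2(2) sub(1)[OF x1(2)]]
          by cases simp_all
      qed
    qed
  qed
qed

text \<open>If points of both parts shared a row or a column, the later of them would be reached
  from the earlier one and lie in both parts.\<close>

lemma split_tree_parts:
  assumes t: "complete_tree a b A"
  shows "split_tree a b A (left_part a b A) (right_part a b A)"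
proof -
  note sub = subsetD[OF left_part_subset] subsetD[OF right_part_subset]
  have row: "(x, y) \<in> left_part a b A \<Longrightarrow> (x, y') \<in> right_part a b A \<Longrightarrow> False" for x y y'
    using parts_disjoint[OF t] left_part_intros(2) right_part_intros(2) sub
    by (metis linorder_neqE_nat)
  have col: "(x, y) \<in> left_part a b A \<Longrightarrow> (x', y) \<in> right_part a b A \<Longrightarrow> False" for x x' y
    using parts_disjoint[OF t] left_part_intros(3) right_part_intros(3) sub
    by (metis linorder_neqE_nat)
  have "A - {(a, b)} \<subseteq> left_part a b A \<union> right_part a b A"
    using parts_cover[OF t] by auto
  then have "A = insert (a, b) (left_part a b A \<union> right_part a b A)"
    using left_part_subset[of a b A] right_part_subset[of a b A] complete_treeD(2)[OF t] by blast
  moreover have "a \<notin> Domain (left_part a b A)" "b \<notin> Range (right_part a b A)"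
    using left_part_gt[of _ a b A] right_part_gt[of _ a b A] by fastforce+
  moreover have "Domain (left_part a b A) \<inter> Domain (right_part a b A) = {}"
    "Range (left_part a b A) \<inter> Range (right_part a b A) = {}"
    using row col by blast+
  ultimately show ?thesis
    unfolding split_tree_def by blast
qed

lemma split_tree_converse: "split_tree a b A D E \<Longrightarrow> split_tree b a (A\<inverse>) (E\<inverse>) (D\<inverse>)"
  unfolding split_tree_def by auto

text \<open>A step from a point of \<open>D\<close> stays in \<open>D\<close>: \<open>E\<close> has
  no row or column in common with \<open>D\<close>, and the left part never returns to row
  \<open>a\<close>, where the root lies.\<close>

lemma left_part_subset_split:
  assumes s: "split_tree a b A D E"
  shows "left_part a b A \<subseteq> D"
proof -
  have "(x, y) \<in> left_part a b A \<Longrightarrow> (x, y) \<in> D" for x y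
  proof (induction "x + y" arbitrary: x y rule: less_induct)
    case less
    have A: "(x, y) \<in> A" "a < x" using less.prems left_part_gt left_part_subset by fastforce+
    from less.prems show ?case
    proof (cases rule: left_part_cases)
      case 1
      then show ?thesis using A split_treeD[OF s] by auto
    next
      case (2 y')
      then show ?thesis using less.hyps[of x y'] A split_treeD[OF s] by auto
    next
      case (3 x')
      then show ?thesis using less.hyps[of x' y] A split_treeD[OF s] by auto
    qed
  qed
  then show ?thesis by auto
qed

text \<open>The parts lie inside \<open>D\<close> and \<open>E\<close> and cover their disjoint
  union, so both inclusions are equalities. This will give the injectivity of gluing.\<close>

lemma split_tree_unique:
  assumes t: "complete_tree a b A" and s: "split_tree a b A D E"
  shows "D = left_part a b A \<and> E = right_part a b A"
proof -
  have 1: "left_part a b A \<subseteq> D" by (rule left_part_subset_split[OF s])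
  have "left_part b a (A\<inverse>) \<subseteq> E\<inverse>" by (rule left_part_subset_split[OF split_tree_converse[OF s]])
  then have 2: "right_part a b A \<subseteq> E"
    using left_part_converse[of b a "A\<inverse>"] by auto
  have 3: "D \<inter> E = {}" "(a, b) \<notin> D" "(a, b) \<notin> E" "D \<subseteq> A" "E \<subseteq> A"
    using split_treeD[OF s] by auto
  have "A - {(a, b)} \<subseteq> left_part a b A \<union> right_part a b A"
    using parts_cover[OF t] by auto
  then have "D \<union> E \<subseteq> left_part a b A \<union> right_part a b A" using 3 by blast
  then show ?thesis using 1 2 3 by blast
qed

section \<open>Cutting a tree into its two subtrees and gluing them back\<close>

lemma split_tree_mem:
  assumes "split_tree a b A D E" "(x, y) \<in> D"
  shows "(x, y') \<in> A \<longleftrightarrow> (x, y') \<in> D" "(x', y) \<in> A \<longleftrightarrow> (x', y) \<in> D \<or> (x', y) = (a, b)"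
  using assms by (auto simp: split_tree_def)

lemma left_part_nonempty:
  "left_part a b A \<noteq> {} \<Longrightarrow> \<exists>x>a. (x, b) \<in> A"
proof -
  assume "left_part a b A \<noteq> {}"
  then obtain x y where "(x, y) \<in> left_part a b A" by auto
  then show ?thesis
    unfolding left_part_def by (induction "(x, y)" arbitrary: x y rule: descendants.induct) auto
qed

lemma right_part_nonempty:
  "right_part a b A \<noteq> {} \<Longrightarrow> \<exists>y>b. (a, y) \<in> A"
  using left_part_nonempty[of b a "A\<inverse>"] left_part_converse[of b a "A\<inverse>"] by auto

text \<open>Some vertex lies in one of the parts, so the root has one child; completeness at the
  root provides the other.\<close>

lemma root_children:
  assumes t: "complete_tree a b A" and ne: "A \<noteq> {(a, b)}"
  shows "\<exists>x>a. (x, b) \<in> A" "\<exists>y>b. (a, y) \<in> A"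
proof -
  note tD = complete_treeD[OF t]
  obtain p where "p \<in> A" "p \<noteq> (a, b)" using ne tD(2) by blast
  then have "left_part a b A \<noteq> {} \<or> right_part a b A \<noteq> {}"
    using parts_cover[OF t, of "fst p" "snd p"] by auto
  then show "\<exists>x>a. (x, b) \<in> A" "\<exists>y>b. (a, y) \<in> A"
    using left_part_nonempty right_part_nonempty tD(6)[OF tD(2)] by blast+
qed

text \<open>The new root is the point of column \<open>b\<close> in the smallest row
  \<open>c\<close> of \<open>D\<close>. Within rows of \<open>D\<close> nothing changes on passing
  from \<open>A\<close> to \<open>D\<close>; within its columns only \<open>(a, b)\<close> is
  lost.\<close>

lemma complete_tree_left_part:
  assumes t: "complete_tree a b A" and s: "split_tree a b A D E" and ne: "A \<noteq> {(a, b)}"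
  shows "complete_tree (Min (Domain D)) b D" "a < Min (Domain D)"
proof -
  note tD = complete_treeD[OF t] and sD = split_treeD[OF s] and mem = split_tree_mem[OF s]
  have DA: "D \<subseteq> A" using sD(1) by auto
  have finD: "finite D" using tD(1) DA finite_subset by blast
  then have fin: "finite (Domain D)" by (simp add: finite_Domain)
  obtain z where "a < z" "(z, b) \<in> A" using root_children[OF t ne] by blast
  then have "(z, b) \<in> D" using sD by auto
  then have Dne: "Domain D \<noteq> {}" by auto
  define c where "c = Min (Domain D)"
  have c_le: "c \<le> x" if "(x, y) \<in> D" for x y using that fin by (auto simp: c_def intro: Min_le)
  have a_lt: "a < x" if "(x, y) \<in> D" for x y
    using that tD(3)[of x y] DA sD(4)[of y] by (metis le_neq_implies_less subsetD)
  have "\<exists>y. (c, y) \<in> D" using Min_in[OF fin Dne] by (auto simp: c_def)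
  then obtain y where y: "(c, y) \<in> D" "\<And>y'. y' < y \<Longrightarrow> (c, y') \<notin> D"
    using exists_least_iff[of "\<lambda>y. (c, y) \<in> D"] by blast
  have ac: "a < c" using a_lt y by blast
  \<comment> \<open>Otherwise the first vertex of row \<open>c\<close> has a predecessor in
    \<open>A\<close>. In its row this contradicts the choice of \<open>y\<close>, in its column the
    minimality of \<open>c\<close>.\<close>
  have "y = b"
  proof (rule ccontr)
    assume "y \<noteq> b"
    then have "(\<exists>y'<y. (c, y') \<in> A) \<or> (\<exists>x'<c. (x', y) \<in> A)"
      using tD(5)[of c y] y DA by blast
    then show False
      using y \<open>y \<noteq> b\<close> c_le mem[OF y(1)] by (metis leD prod.inject)
  qed
  then have root: "(c, b) \<in> D" using y by simp
  have "complete_tree c b D"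
    unfolding complete_tree_def
  proof (intro conjI allI impI)
    fix x y assume xy: "(x, y) \<in> D"
    show "c \<le> x" "b \<le> y" using c_le[OF xy] tD(4) DA xy by blast+
    have xyA: "(x, y) \<in> A" using xy DA by blast
    show "(\<exists>y'>y. (x, y') \<in> D) = (\<exists>x'>x. (x', y) \<in> D)"
      using tD(6)[OF xyA] mem[OF xy] a_lt[OF xy] by (metis not_less_iff_gr_or_eq prod.inject)
    assume nr: "(x, y) \<noteq> (c, b)"
    show "(\<exists>y'<y. (x, y') \<in> D) \<noteq> (\<exists>x'<x. (x', y) \<in> D)"
    proof (cases "y = b")
      \<comment> \<open>In column \<open>b\<close> the lost predecessor \<open>(a, b)\<close> is
        replaced by \<open>(c, b)\<close>.\<close>
      case True
      then have "c < x" using nr c_le[OF xy] by auto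
      then show ?thesis using True tD(4) DA root by (metis leD subsetD)
    next
      case False
      then show ?thesis using tD(5)[OF xyA] mem[OF xy] by simp
    qed
  qed (use finD root in auto)
  then show "complete_tree (Min (Domain D)) b D" "a < Min (Domain D)" using ac by (simp_all add: c_def)
qed

lemma complete_tree_right_part:
  assumes t: "complete_tree a b A" and s: "split_tree a b A D E" and ne: "A \<noteq> {(a, b)}"
  shows "complete_tree a (Min (Range E)) E" "b < Min (Range E)"
proof -
  have "A\<inverse> \<noteq> {(b, a)}" using ne by auto
  note 1 = complete_tree_left_part[OF complete_tree_converse[OF t] split_tree_converse[OF s] this]
  show "complete_tree a (Min (Range E)) E" "b < Min (Range E)"
    using complete_tree_converse[OF 1(1)] 1(2) by simp_all
qed

text \<open>Gluing adds no point to the rows of \<open>D\<close> and only \<open>(a, b)\<close> to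
  its columns. This point precedes every vertex of column \<open>b\<close>, and so gives the old
  root \<open>(c, b)\<close> its parent.\<close>

lemma compose_left_vertex:
  assumes D: "complete_tree c b D" and s: "split_tree a b A D E" and ac: "a < c" and xy: "(x, y) \<in> D"
  shows "(\<exists>y'<y. (x, y') \<in> A) \<noteq> (\<exists>x'<x. (x', y) \<in> A)"
        "(\<exists>y'>y. (x, y') \<in> A) = (\<exists>x'>x. (x', y) \<in> A)"
proof -
  note tD = complete_treeD[OF D] and mem = split_tree_mem[OF s xy]
  have ax: "a < x" using tD(3)[OF xy] ac by simp
  then have "(x', y) \<in> A \<longleftrightarrow> (x', y) \<in> D" if "x < x'" for x' using mem(2) that by auto
  then show "(\<exists>y'>y. (x, y') \<in> A) = (\<exists>x'>x. (x', y) \<in> A)"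
    using tD(6)[OF xy] mem(1) by blast
  show "(\<exists>y'<y. (x, y') \<in> A) \<noteq> (\<exists>x'<x. (x', y) \<in> A)"
  proof (cases "y = b")
    case True
    then have "(a, y) \<in> A" using mem(2) by blast
    moreover have "\<not> (\<exists>y'<y. (x, y') \<in> A)" using mem(1) tD(4) True leD by blast
    ultimately show ?thesis using ax by blast
  next
    case False
    then show ?thesis using tD(5)[OF xy] mem by simp
  qed
qed

text \<open>This inverts the splitting. The vertices of \<open>E\<close> are handled by transposing
  the argument for \<open>D\<close>.\<close>

lemma complete_tree_compose:
  assumes D: "complete_tree c b D" and E: "complete_tree a d E" and ac: "a < c" and bd: "b < d"
    and disj: "Domain D \<inter> Domain E = {}" "Range D \<inter> Range E = {}"
  defines "A \<equiv> insert (a, b) (D \<union> E)"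
  shows "complete_tree a b A" "split_tree a b A D E"
proof -
  note tD = complete_treeD[OF D] and tE = complete_treeD[OF E]
  show s: "split_tree a b A D E"
    unfolding split_tree_def A_def using disj tD(3) tE(4) ac bd by fastforce
  note locD = compose_left_vertex[OF D s ac]
    and locE = compose_left_vertex[OF complete_tree_converse[OF E] split_tree_converse[OF s] bd, simplified]
  have mem: "(x, y) = (a, b) \<or> (x, y) \<in> D \<or> (x, y) \<in> E" if "(x, y) \<in> A" for x y
    using that by (auto simp: A_def)
  show "complete_tree a b A"
    unfolding complete_tree_def
  proof (intro conjI allI impI)
    show "finite A" "(a, b) \<in> A" using tD(1) tE(1) by (auto simp: A_def)
    fix x y assume xy: "(x, y) \<in> A"
    show "a \<le> x" "b \<le> y" using mem[OF xy] tD(3,4) tE(3,4) ac bd by fastforce+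
    show "(\<exists>y'>y. (x, y') \<in> A) = (\<exists>x'>x. (x', y) \<in> A)"
    proof (cases "(x, y) = (a, b)")
      case True
      then show ?thesis using ac bd tD(2) tE(2) unfolding A_def by blast
    next
      case False
      then show ?thesis using mem[OF xy] locD(2) locE(2) by blast
    qed
    assume "(x, y) \<noteq> (a, b)"
    then show "(\<exists>y'<y. (x, y') \<in> A) \<noteq> (\<exists>x'<x. (x', y) \<in> A)"
      using mem[OF xy] locD(1) locE(1) by blast
  qed
qed

section \<open>Trees with prescribed rows and columns\<close>

text \<open>All conditions only compare coordinates, and strictly monotone maps preserve and reflect
  comparisons.\<close>

lemma complete_tree_relabel:
  assumes f: "strict_mono_on R f" and g: "strict_mono_on C g"
    and A: "A \<subseteq> R \<times> C" and a: "a \<in> R" and b: "b \<in> C"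
  shows "complete_tree (f a) (g b) (map_prod f g ` A) \<longleftrightarrow> complete_tree a b A"
proof -
  define A' where "A' = map_prod f g ` A"
  have injf: "inj_on f R" and injg: "inj_on g C"
    using f g strict_mono_on_imp_inj_on by auto
  have mem: "(f x, g y) \<in> A' \<longleftrightarrow> (x, y) \<in> A" if "x \<in> R" "y \<in> C" for x y
    using that A injf injg by (force simp: A'_def dest: inj_onD)
  have less: "f x < f x' \<longleftrightarrow> x < x'" "f x \<le> f x' \<longleftrightarrow> x \<le> x'" "f x = f x' \<longleftrightarrow> x = x'"
    if "x \<in> R" "x' \<in> R" for x x'
    using that f injf strict_mono_on_less strict_mono_on_less_eq by (blast dest: inj_onD)+
  have lessg: "g y < g y' \<longleftrightarrow> y < y'" "g y \<le> g y' \<longleftrightarrow> y \<le> y'" "g y = g y' \<longleftrightarrow> y = y'"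
    if "y \<in> C" "y' \<in> C" for y y'
    using that g injg strict_mono_on_less strict_mono_on_less_eq by (blast dest: inj_onD)+
  have inA: "x \<in> R" "y \<in> C" if "(x, y) \<in> A" for x y using A that by auto
  have row: "(f x, v) \<in> A' \<longleftrightarrow> (\<exists>y\<in>C. v = g y \<and> (x, y) \<in> A)" if "x \<in> R" for x v
    using that injf A by (fastforce simp: A'_def dest: inj_onD)
  have col: "(u, g y) \<in> A' \<longleftrightarrow> (\<exists>x\<in>R. u = f x \<and> (x, y) \<in> A)" if "y \<in> C" for u y
    using that injg A by (fastforce simp: A'_def dest: inj_onD)
  have all: "(\<forall>u v. (u, v) \<in> A' \<longrightarrow> Q u v) = (\<forall>x y. (x, y) \<in> A \<longrightarrow> Q (f x) (g y))" for Q
    by (auto simp: A'_def)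
  have 1: "(\<exists>v<g y. (f x, v) \<in> A') = (\<exists>y'<y. (x, y') \<in> A)" if "(x, y) \<in> A" for x y
    using that inA row lessg by metis
  have 2: "(\<exists>u<f x. (u, g y) \<in> A') = (\<exists>x'<x. (x', y) \<in> A)" if "(x, y) \<in> A" for x y
    using that inA col less by metis
  have 3: "(\<exists>v>g y. (f x, v) \<in> A') = (\<exists>y'>y. (x, y') \<in> A)" if "(x, y) \<in> A" for x y
    using that inA row lessg by metis
  have 4: "(\<exists>u>f x. (u, g y) \<in> A') = (\<exists>x'>x. (x', y) \<in> A)" if "(x, y) \<in> A" for x y
    using that inA col less by metis
  have fin: "finite A' \<longleftrightarrow> finite A"
    unfolding A'_def using A by (intro finite_image_iff inj_on_subset[OF map_prod_inj_on[OF injf injg]])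
  show ?thesis
    unfolding A'_def[symmetric] complete_tree_def all fin mem[OF a b]
    by (simp add: 1 2 3 4 less lessg inA a b cong: conj_cong imp_cong)
qed

text \<open>Since the root has the least row and the least column, \<open>R\<close> and
  \<open>C\<close> determine its place.\<close>

definition trees :: "nat set \<Rightarrow> nat set \<Rightarrow> (nat \<times> nat) set set" where
  "trees R C = {A. complete_tree (Min R) (Min C) A \<and> Domain A = R \<and> Range A = C}"

lemma trees_subset: "trees R C \<subseteq> Pow (R \<times> C)"
  unfolding trees_def by auto

lemma finite_trees: "finite R \<Longrightarrow> finite C \<Longrightarrow> finite (trees R C)"
  by (rule finite_subset[OF trees_subset]) simp

lemma trees_empty: "R = {} \<or> C = {} \<Longrightarrow> trees R C = {}"
  unfolding trees_def using complete_treeD(2) by fastforce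

lemma Min_strict_mono_image:
  fixes f :: "nat \<Rightarrow> nat"
  assumes "strict_mono_on R f" "finite R" "R \<noteq> {}"
  shows "Min (f ` R) = f (Min R)"
proof (rule Min_eqI)
  fix y assume "y \<in> f ` R"
  then show "f (Min R) \<le> y"
    using assms strict_mono_on_less_eq[OF assms(1), of "Min R"] by auto
qed (use assms in auto)

text \<open>The increasing enumerations \<open>f\<close> of \<open>R\<close> and \<open>g\<close> of
  \<open>C\<close> relabel trees bijectively.\<close>

lemma card_trees:
  assumes R: "finite R" and C: "finite C"
  shows "card (trees R C) = card (trees {..<card R} {..<card C})"
proof (cases "R = {} \<or> C = {}")
  case True
  then show ?thesis using trees_empty[of R C] trees_empty[of "{..<card R}" "{..<card C}"] by auto
next
  case False
  obtain f where f: "bij_betw f {..<card R} R" "strict_mono_on {..<card R} f"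
    using ex_bij_betw_strict_mono_card[OF R] .
  obtain g where g: "bij_betw g {..<card C} C" "strict_mono_on {..<card C} g"
    using ex_bij_betw_strict_mono_card[OF C] .
  have ne: "{..<card R} \<noteq> {}" "{..<card C} \<noteq> {}" using False R C by (auto simp: lessThan_empty_iff)
  have Min: "Min R = f (Min {..<card R})" "Min C = g (Min {..<card C})"
    using Min_strict_mono_image[OF f(2) _ ne(1)] Min_strict_mono_image[OF g(2) _ ne(2)]
      f(1) g(1) by (auto simp: bij_betw_def)
  have iff: "map_prod f g ` A \<in> trees R C \<longleftrightarrow> A \<in> trees {..<card R} {..<card C}"
    if A: "A \<subseteq> {..<card R} \<times> {..<card C}" for A
  proof -
    have DR: "Domain A \<subseteq> {..<card R}" "Range A \<subseteq> {..<card C}" using A by auto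
    have "Domain (map_prod f g ` A) = f ` Domain A" "Range (map_prod f g ` A) = g ` Range A"
      by force+
    moreover have "f ` Domain A = R \<longleftrightarrow> Domain A = {..<card R}"
      using f(1) DR(1) by (metis bij_betw_def inj_on_image_eq_iff order_refl)
    moreover have "g ` Range A = C \<longleftrightarrow> Range A = {..<card C}"
      using g(1) DR(2) by (metis bij_betw_def inj_on_image_eq_iff order_refl)
    moreover have "complete_tree (Min R) (Min C) (map_prod f g ` A)
        \<longleftrightarrow> complete_tree (Min {..<card R}) (Min {..<card C}) A"
      unfolding Min by (rule complete_tree_relabel[OF f(2) g(2) A]) (use ne in \<open>auto simp del: lessThan_iff\<close>)
    ultimately show ?thesis unfolding trees_def by simp
  qed
  have inj: "inj_on (map_prod f g) ({..<card R} \<times> {..<card C})"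
    using f(1) g(1) by (auto simp: bij_betw_def intro: map_prod_inj_on)
  have img: "map_prod f g ` ({..<card R} \<times> {..<card C}) = R \<times> C"
    using f(1) g(1) by (simp add: map_prod_surj_on bij_betw_def)
  have "trees R C = (\<lambda>A. map_prod f g ` A) ` trees {..<card R} {..<card C}"
  proof (intro equalityI subsetI)
    fix B assume B: "B \<in> trees R C"
    then have "B \<subseteq> map_prod f g ` ({..<card R} \<times> {..<card C})" using trees_subset img by blast
    then obtain A where "A \<subseteq> {..<card R} \<times> {..<card C}" "B = map_prod f g ` A"
      by (auto simp only: subset_image_iff)
    then show "B \<in> (\<lambda>A. map_prod f g ` A) ` trees {..<card R} {..<card C}"
      using B iff by blast
  next
    fix B assume "B \<in> (\<lambda>A. map_prod f g ` A) ` trees {..<card R} {..<card C}"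
    then show "B \<in> trees R C" using iff trees_subset by blast
  qed
  moreover have "inj_on (\<lambda>A. map_prod f g ` A) (trees {..<card R} {..<card C})"
    by (rule inj_on_subset[OF inj_on_image_Pow[OF inj] trees_subset])
  ultimately show ?thesis by (simp add: card_image)
qed

section \<open>Numbers of rows, columns and inner vertices\<close>

text \<open>In a complete tree a later point in the row alone signals two children.\<close>

definition inner_vertices :: "(nat \<times> nat) set \<Rightarrow> (nat \<times> nat) set" where
  "inner_vertices A = {(x, y) \<in> A. \<exists>y'>y. (x, y') \<in> A}"

lemma inner_vertices_split:
  assumes t: "complete_tree a b A" and s: "split_tree a b A D E" and ne: "A \<noteq> {(a, b)}"
  shows "inner_vertices A = insert (a, b) (inner_vertices D \<union> inner_vertices E)"
proof -
  have 1: "(x, y) \<in> A \<longleftrightarrow> (x, y) = (a, b) \<or> (x, y) \<in> D \<or> (x, y) \<in> E" for x y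
    using split_treeD(1)[OF s] by auto
  have 2: "(x, y') \<in> A \<longleftrightarrow> (x, y') \<in> D" if "(x, y) \<in> D" for x y y'
    using split_tree_mem(1)[OF s that] .
  have 3: "y' > y \<Longrightarrow> (x, y') \<in> A \<longleftrightarrow> (x, y') \<in> E" if "(x, y) \<in> E" for x y y'
  proof -
    assume "y < y'"
    have "b \<le> y" using that complete_treeD(4)[OF t] split_treeD(1)[OF s] by blast
    then show "(x, y') \<in> A \<longleftrightarrow> (x, y') \<in> E"
      using \<open>y < y'\<close> split_tree_mem(2)[OF split_tree_converse[OF s], of y x y'] that by auto
  qed
  have 4: "\<exists>y'>b. (a, y') \<in> A" using root_children[OF t ne] by blast
  show ?thesis
    unfolding inner_vertices_def using 1 2 3 4 by blast
qed

text \<open>The root's row already occurs in \<open>E\<close> and its column in \<open>D\<close>, so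
  rows and columns simply add up: \<open>(i + 1) + (j + 1)\<close> of each for subtrees with
  \<open>i\<close> and \<open>j\<close> inner vertices. The whole tree has \<open>i + j + 1\<close>
  inner vertices.\<close>

lemma card_Domain_Range:
  "complete_tree a b A \<Longrightarrow> card (Domain A) = Suc (card (inner_vertices A)) \<and>
    card (Range A) = Suc (card (inner_vertices A))"
proof (induction "card A" arbitrary: a b A rule: less_induct)
  case less
  note t = less.prems
  show ?case
  proof (cases "A = {(a, b)}")
    case True
    then have "inner_vertices A = {}" by (auto simp: inner_vertices_def)
    then show ?thesis using True by simp
  next
    case False
    define D E where "D = left_part a b A" and "E = right_part a b A"
    have s: "split_tree a b A D E" unfolding D_def E_def by (rule split_tree_parts[OF t])
    note sD = split_treeD[OF s]
    note D = complete_tree_left_part(1)[OF t s False] and E = complete_tree_right_part(1)[OF t s False]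
    have finA: "finite A" by (rule complete_treeD(1)[OF t])
    have "(a, b) \<in> A" "(a, b) \<notin> D" "(a, b) \<notin> E" "D \<subseteq> A" "E \<subseteq> A" using sD by auto
    then have psub: "D \<subset> A" "E \<subset> A" by auto
    then have fin: "finite D" "finite E" using finA finite_subset by blast+
    have "card D < card A" "card E < card A" using psub finA by (auto intro: psubset_card_mono)
    note IH = less.hyps[OF this(1) D] less.hyps[OF this(2) E]
    have dom: "Domain A = Domain D \<union> Domain E" "Domain D \<inter> Domain E = {}"
      using s complete_treeD(2)[OF E] by (auto simp: split_tree_def)
    have ran: "Range A = Range D \<union> Range E" "Range D \<inter> Range E = {}"
      using s complete_treeD(2)[OF D] by (auto simp: split_tree_def)
    have "inner_vertices D \<inter> inner_vertices E = {}" "(a, b) \<notin> inner_vertices D \<union> inner_vertices E"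
      "finite (inner_vertices D)" "finite (inner_vertices E)"
      using sD(2,4,5) fin by (auto simp: inner_vertices_def intro: finite_subset)
    then have "card (inner_vertices A) = Suc (card (inner_vertices D) + card (inner_vertices E))"
      unfolding inner_vertices_split[OF t s False] by (simp add: card_Un_disjoint)
    then show ?thesis
      using IH dom ran fin by (simp add: card_Un_disjoint finite_Domain finite_Range)
  qed
qed

lemma trees_card_neq: "card R \<noteq> card C \<Longrightarrow> trees R C = {}"
proof (rule ccontr)
  assume neq: "card R \<noteq> card C" and "trees R C \<noteq> {}"
  then obtain A where "complete_tree (Min R) (Min C) A" "Domain A = R" "Range A = C"
    unfolding trees_def by blast
  then show False using card_Domain_Range neq by metis
qed

section \<open>The recursion for the number of trees\<close>

lemma sum_Pow_card:
  fixes h :: "nat \<Rightarrow> 'a::comm_semiring_1"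
  assumes "finite X"
  shows "(\<Sum>S\<in>Pow X. h (card S)) = (\<Sum>m\<le>card X. of_nat (card X choose m) * h m)"
proof -
  have "(\<Sum>S\<in>Pow X. h (card S)) = (\<Sum>m\<le>card X. \<Sum>S\<in>{S \<in> Pow X. card S = m}. h (card S))"
    by (rule sum.group[symmetric]) (use assms in \<open>auto intro: card_mono\<close>)
  also have "\<dots> = (\<Sum>m\<le>card X. of_nat (card X choose m) * h m)"
    by (rule sum.cong) (use n_subsets[OF assms] in \<open>auto simp: Collect_conj_eq Pow_def\<close>)
  finally show ?thesis .
qed

text \<open>The argument counts rows, not inner vertices: \<open>b k\<close> is
  \<open>num_trees (Suc k)\<close>.\<close>

definition num_trees :: "nat \<Rightarrow> nat" where
  "num_trees n = card (trees {..<n} {..<n})"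

lemma card_trees_eq:
  assumes "finite R" "finite C"
  shows "card (trees R C) = (if card R = card C then num_trees (card R) else 0)"
  using card_trees[OF assms] trees_card_neq[of R C] by (cases "card R = card C") (simp_all add: num_trees_def)

lemma trees_singleton: "trees {a} {b} = {{(a, b)}}"
proof (intro equalityI subsetI)
  fix A assume "A \<in> trees {a} {b}"
  then have "A \<subseteq> {a} \<times> {b}" "(a, b) \<in> A"
    using trees_subset[of "{a}" "{b}"] complete_treeD(2) by (auto simp: trees_def)
  then show "A \<in> {{(a, b)}}" by auto
next
  fix A assume "A \<in> {{(a, b)}}"
  then show "A \<in> trees {a} {b}" by (auto simp: trees_def complete_tree_def)
qed

lemma num_trees_1: "num_trees (Suc 0) = 1"
  using card_trees_eq[of "{0}" "{0}"] trees_singleton[of 0 0] by simp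

text \<open>
  Indexed by the rows \<open>fst p\<close> of the left subtree and by its columns \<open>snd p\<close> other than column \<open>0\<close>.
\<close>

definition subtree_pairs ::
  "nat set \<Rightarrow> ((nat set \<times> nat set) \<times> ((nat \<times> nat) set \<times> (nat \<times> nat) set)) set" where
  "subtree_pairs X = (SIGMA p:Pow X \<times> Pow X.
     trees (fst p) (insert 0 (snd p)) \<times> trees (insert 0 (X - fst p)) (X - snd p))"

lemma Min_insert_0: "finite X \<Longrightarrow> Min (insert 0 X) = (0::nat)"
  by (rule Min_eqI) auto

text \<open>Besides gluing, this recovers the index sets from \<open>D\<close>, so that a glued tree
  determines its index.\<close>

lemma subtree_pairs_compose:
  assumes X: "X = {1..k}" and m: "((R', C'), (D, E)) \<in> subtree_pairs X"
  shows "insert (0, 0) (D \<union> E) \<in> trees {..k} {..k}"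
    and "split_tree 0 0 (insert (0, 0) (D \<union> E)) D E"
    and "R' = Domain D" "C' = Range D - {0}"
proof -
  have sub: "R' \<subseteq> X" "C' \<subseteq> X" and D: "D \<in> trees R' (insert 0 C')"
    and E: "E \<in> trees (insert 0 (X - R')) (X - C')"
    using m by (auto simp: subtree_pairs_def)
  have fin: "finite R'" "finite C'" "finite X" using sub X finite_subset by auto
  have pos: "0 \<notin> X" using X by simp
  have dom: "Domain D = R'" "Range D = insert 0 C'" "Domain E = insert 0 (X - R')" "Range E = X - C'"
    using D E by (auto simp: trees_def)
  have D': "complete_tree (Min R') 0 D" and E': "complete_tree 0 (Min (X - C')) E"
    using D E fin by (auto simp: trees_def Min_insert_0)
  \<comment> \<open>Both sets are nonempty because each subtree contains its root; hence their
    minima lie in \<open>X\<close> and are positive, as gluing below \<open>(0, 0)\<close>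
    requires.\<close>
  have "R' \<noteq> {}" "X - C' \<noteq> {}" using complete_treeD(2)[OF D'] complete_treeD(2)[OF E'] dom by blast+
  then have "Min R' \<in> X" "Min (X - C') \<in> X" using fin sub Min_in by blast+
  then have "0 < Min R'" "0 < Min (X - C')" using pos by (metis gr0I)+
  note c = complete_tree_compose[OF D' E' this]
  have disj: "Domain D \<inter> Domain E = {}" "Range D \<inter> Range E = {}"
    using dom sub pos by auto
  show "split_tree 0 0 (insert (0, 0) (D \<union> E)) D E" by (rule c(2)[OF disj])
  have k: "{..k} = insert 0 X" using X by auto
  have "Domain (insert (0, 0) (D \<union> E)) = insert 0 X" "Range (insert (0, 0) (D \<union> E)) = insert 0 X"
    unfolding Domain_insert Range_insert Domain_Un_eq Range_Un_eq dom using sub by auto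
  moreover have "Min {..k} = 0" unfolding k using fin Min_insert_0 by blast
  ultimately show "insert (0, 0) (D \<union> E) \<in> trees {..k} {..k}"
    using c(1)[OF disj] k by (simp add: trees_def)
  show "R' = Domain D" "C' = Range D - {0}" using dom sub pos by auto
qed

text \<open>It is applied with \<open>a = 0\<close> to the rows, where \<open>Q\<close> belongs to
  the right subtree, and to the columns, where \<open>Q\<close> belongs to the left one.\<close>

lemma complement_insert:
  assumes "P \<union> Q = insert a X" "P \<inter> Q = {}" "a \<notin> P" "a \<in> Q"
  shows "P \<subseteq> X \<and> Q = insert a (X - P)"
proof -
  have iff: "x \<in> P \<or> x \<in> Q \<longleftrightarrow> x = a \<or> x \<in> X" for x using assms(1) by (simp add: set_eq_iff)
  have "x \<in> Q \<longleftrightarrow> x = a \<or> x \<in> X \<and> x \<notin> P" for x using iff[of x] assms(2-4) by auto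
  moreover have "x \<in> X" if "x \<in> P" for x using iff[of x] that assms(3) by auto
  ultimately show ?thesis by (simp add: set_eq_iff subset_eq)
qed

text \<open>Gluing is a bijection: uniqueness of the splitting makes it injective, existence makes
  it surjective.\<close>

lemma card_subtree_pairs:
  assumes k: "k > 0" and X: "X = {1..k}"
  shows "card (trees {..k} {..k}) = card (subtree_pairs X)"
proof -
  define h :: "(nat set \<times> nat set) \<times> ((nat \<times> nat) set \<times> (nat \<times> nat) set) \<Rightarrow> (nat \<times> nat) set"
    where "h = (\<lambda>((R', C'), (D, E)). insert (0, 0) (D \<union> E))"
  note comp = subtree_pairs_compose[OF X]
  have Min: "Min {..k} = 0" by (rule Min_eqI) auto
  have tree: "complete_tree 0 0 A" "Domain A = {..k}" "Range A = {..k}" if "A \<in> trees {..k} {..k}" for A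
    using that Min by (auto simp: trees_def)
  have "inj_on h (subtree_pairs X)"
  proof (rule inj_onI)
    fix p q assume pq: "p \<in> subtree_pairs X" "q \<in> subtree_pairs X" "h p = h q"
    obtain R1 C1 D1 E1 R2 C2 D2 E2 where eq: "p = ((R1, C1), (D1, E1))" "q = ((R2, C2), (D2, E2))"
      by (metis surj_pair)
    note p = comp[OF pq(1)[unfolded eq]] and q = comp[OF pq(2)[unfolded eq]]
    have A: "insert (0, 0) (D1 \<union> E1) = insert (0, 0) (D2 \<union> E2)"
      using pq(3) by (simp add: eq h_def)
    have "D1 = D2 \<and> E1 = E2"
      using split_tree_unique[OF tree(1)[OF p(1)] p(2)]
        split_tree_unique[OF tree(1)[OF q(1)] q(2)] A by simp
    then show "p = q" using p(3,4) q(3,4) by (simp add: eq)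
  qed
  moreover have "h ` subtree_pairs X = trees {..k} {..k}"
  proof (intro equalityI subsetI)
    fix A assume "A \<in> h ` subtree_pairs X"
    then show "A \<in> trees {..k} {..k}" using comp(1) by (auto simp: h_def)
  next
    fix A assume "A \<in> trees {..k} {..k}"
    note t = tree[OF this]
    have "k \<in> Domain A" using t(2) by simp
    \<comment> \<open>A row \<open>k > 0\<close> is occupied, so the tree is not just its
      root.\<close>
    then have ne: "A \<noteq> {(0, 0)}" using k by auto
    define D E where "D = left_part 0 0 A" and "E = right_part 0 0 A"
    have s: "split_tree 0 0 A D E" unfolding D_def E_def by (rule split_tree_parts[OF t(1)])
    note D = complete_tree_left_part(1)[OF t(1) s ne] and E = complete_tree_right_part(1)[OF t(1) s ne]
    have z: "0 \<in> Range D" "0 \<in> Domain E" "0 \<notin> Domain D" "0 \<notin> Range E"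
      using complete_treeD(2)[OF D] complete_treeD(2)[OF E] split_treeD(4,5)[OF s] by auto
    have A: "A = insert (0, 0) (D \<union> E)" by (rule split_treeD(1)[OF s])
    have iX: "insert 0 X = {..k}" using X by auto
    have "insert 0 (Domain D \<union> Domain E) = {..k}" "insert 0 (Range D \<union> Range E) = {..k}"
      using t(2,3) unfolding A Domain_insert Range_insert Domain_Un_eq Range_Un_eq by simp_all
    then have un: "Domain D \<union> Domain E = insert 0 X" "Range E \<union> Range D = insert 0 X"
      using z by (simp_all add: insert_absorb iX Un_commute)
    have disj: "Domain D \<inter> Domain E = {}" "Range E \<inter> Range D = {}"
      using s by (auto simp: split_tree_def)
    have "0 \<notin> X" using X by simp
    note cD = complement_insert[OF un(1) disj(1) z(3,2)] and cR = complement_insert[OF un(2) disj(2) z(4,1)]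
    have RD: "Range D - {0} = X - Range E" using cR \<open>0 \<notin> X\<close> by (metis Diff_insert_absorb Diff_iff)
    have sets: "Domain D \<subseteq> X" "Range D - {0} \<subseteq> X" "Domain E = insert 0 (X - Domain D)"
      "Range D = insert 0 (Range D - {0})" "Range E = X - (Range D - {0})"
      using cD cR unfolding RD by (simp_all add: double_diff)
    have "finite (insert 0 X)" using X by simp
    then have fin: "finite (Domain E)" "finite (Range D)"
      using un by (metis finite_Un)+
    have "Min (Domain E) = 0" "Min (Range D) = 0"
      by (rule Min_eqI; use z fin in auto)+
    then have "D \<in> trees (Domain D) (Range D)" "E \<in> trees (Domain E) (Range E)"
      using D E by (auto simp: trees_def)
    then have "D \<in> trees (Domain D) (insert 0 (Range D - {0}))"
      "E \<in> trees (insert 0 (X - Domain D)) (X - (Range D - {0}))"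
      by (simp_all only: flip: sets(3,4,5))
    then have "((Domain D, Range D - {0}), (D, E)) \<in> subtree_pairs X"
      using sets(1,2) unfolding subtree_pairs_def by simp
    then show "A \<in> h ` subtree_pairs X"
      by (rule rev_image_eqI) (simp add: h_def A)
  qed
  ultimately show ?thesis by (metis card_image)
qed

lemma num_trees_rec:
  assumes "k > 0"
  shows "num_trees (Suc k) =
    (\<Sum>c<k. (k choose Suc c) * (k choose c) * num_trees (Suc c) * num_trees (k - c))"
proof -
  define X where "X = {1..k}"
  have X: "finite X" "card X = k" "0 \<notin> X" by (auto simp: X_def)
  \<comment> \<open>A tree has as many rows as columns, so the left subtree forces
    \<open>r = Suc c\<close>; the right one then has \<open>k - c\<close> of each.\<close>
  define G where "G r c = (if r = Suc c then num_trees (Suc c) * num_trees (k - c) else 0)" for r c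
  have summand: "card (trees R' (insert 0 C') \<times> trees (insert 0 (X - R')) (X - C')) = G (card R') (card C')"
    if "R' \<subseteq> X" "C' \<subseteq> X" for R' C'
  proof -
    have fin: "finite R'" "finite C'" using that X finite_subset by auto
    have "card R' \<le> k" "card C' \<le> k" using that X card_mono by metis+
    moreover have "0 \<notin> C'" "0 \<notin> X - R'" using that X by auto
    moreover have "card (X - R') = k - card R'" "card (X - C') = k - card C'"
      using that X fin by (simp_all add: card_Diff_subset)
    ultimately show ?thesis
      using fin X by (auto simp: card_cartesian_product card_trees_eq G_def)
  qed
  have "num_trees (Suc k) = card (subtree_pairs X)"
    using card_subtree_pairs[OF assms X_def] by (simp add: num_trees_def lessThan_Suc_atMost)
  also have "\<dots> = (\<Sum>p\<in>Pow X \<times> Pow X. G (card (fst p)) (card (snd p)))"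
    unfolding subtree_pairs_def using X(1)
    by (subst card_SigmaI) (auto intro!: sum.cong finite_cartesian_product finite_trees summand intro: finite_subset)
  also have "\<dots> = (\<Sum>C'\<in>Pow X. \<Sum>R'\<in>Pow X. G (card R') (card C'))"
    by (subst sum.swap) (simp add: sum.cartesian_product case_prod_beta)
  also have "\<dots> = (\<Sum>c\<le>k. (k choose c) * (\<Sum>r\<le>k. (k choose r) * G r c))"
  proof -
    have "(\<Sum>R'\<in>Pow X. G (card R') c) = (\<Sum>r\<le>k. (k choose r) * G r c)" for c
      using sum_Pow_card[OF X(1), of "\<lambda>r. G r c"] X(2) by simp
    then show ?thesis
      using sum_Pow_card[OF X(1), of "\<lambda>c. \<Sum>r\<le>k. (k choose r) * G r c"] X(2) by simp
  qed
  \<comment> \<open>The term \<open>c = k\<close> vanishes, since it would need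
    \<open>r = Suc k\<close> rows.\<close>
  also have "\<dots> = (\<Sum>c<k. (k choose c) * (\<Sum>r\<le>k. (k choose r) * G r c))"
    by (rule sum.mono_neutral_right) (auto simp: G_def not_less)
  also have "\<dots> = (\<Sum>c<k. (k choose c) * ((k choose Suc c) * (num_trees (Suc c) * num_trees (k - c))))"
  proof (rule sum.cong, simp)
    fix c assume "c \<in> {..<k}"
    then have "(\<Sum>r\<le>k. (k choose r) * G r c) = (\<Sum>r\<in>{Suc c}. (k choose r) * G r c)"
      by (intro sum.mono_neutral_right) (auto simp: G_def)
    then show "(k choose c) * (\<Sum>r\<le>k. (k choose r) * G r c) =
      (k choose c) * ((k choose Suc c) * (num_trees (Suc c) * num_trees (k - c)))"
      by (simp add: G_def)
  qed
  finally show ?thesis by (simp add: ac_simps)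
qed

section \<open>Agreement with the definition of complete non-ambiguous trees\<close>

text \<open>By well-ordering a nonempty set has exactly one least element, even if it is infinite.
  Applied to the later points of a row or column, this counts the children of one kind.\<close>

lemma card_least:
  fixes S :: "nat set"
  shows "card {y\<in>S. \<not> (\<exists>z\<in>S. z < y)} = (if S = {} then 0 else 1)"
proof (cases "S = {}")
  case False
  then have "(LEAST y. y \<in> S) \<in> S" by (metis LeastI ex_in_conv)
  then have "{y\<in>S. \<not> (\<exists>z\<in>S. z < y)} = {LEAST y. y \<in> S}"
    using Least_le[of "\<lambda>y. y \<in> S"] by (auto simp: not_less intro: antisym)
  then show ?thesis using False by simp
qed simp

lemma card_children:
  assumes "(x, y) \<in> A"
  shows "card (children A (x, y)) =
    (if \<exists>y'>y. (x, y') \<in> A then 1 else 0) + (if \<exists>x'>x. (x', y) \<in> A then 1 else 0)"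
proof -
  define S where "S = {y'. y' > y \<and> (x, y') \<in> A}"
  define T where "T = {x'. x' > x \<and> (x', y) \<in> A}"
  define S0 where "S0 = {y'\<in>S. \<not> (\<exists>z\<in>S. z < y')}"
  define T0 where "T0 = {x'\<in>T. \<not> (\<exists>z\<in>T. z < x')}"
  have "right_child A (x, y) (u, v) \<longleftrightarrow> u = x \<and> v \<in> S0" for u v
  proof -
    have "(\<exists>r\<in>A. fst r = u \<and> y < snd r \<and> snd r < v) \<longleftrightarrow> (\<exists>z. (u, z) \<in> A \<and> y < z \<and> z < v)"
      by (simp add: Bex_def split_paired_Ex)
    then show ?thesis
      using assms unfolding right_child_def S0_def S_def by auto
  qed
  moreover have "left_child A (x, y) (u, v) \<longleftrightarrow> v = y \<and> u \<in> T0" for u v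
  proof -
    have "(\<exists>r\<in>A. snd r = v \<and> x < fst r \<and> fst r < u) \<longleftrightarrow> (\<exists>z. (z, v) \<in> A \<and> x < z \<and> z < u)"
      by (simp add: Bex_def split_paired_Ex)
    then show ?thesis
      using assms unfolding left_child_def T0_def T_def by auto
  qed
  ultimately have eq: "children A (x, y) = Pair x ` S0 \<union> (\<lambda>x'. (x', y)) ` T0"
    unfolding children_def by (simp add: set_eq_iff image_iff conj_commute)
  have card: "card S0 = (if S = {} then 0 else 1)" "card T0 = (if T = {} then 0 else 1)"
    unfolding S0_def T0_def by (rule card_least)+
  \<comment> \<open>Cardinality 1 implies finiteness; cardinality 0 occurs only when
    \<open>S\<close> or \<open>T\<close>, and with it the subset, is empty.\<close>
  have "finite S0" "finite T0"
    using card by (auto simp: S0_def T0_def split: if_splits intro: card_ge_0_finite)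
  moreover have "Pair x ` S0 \<inter> (\<lambda>x'. (x', y)) ` T0 = {}"
    by (auto simp: S0_def T0_def S_def T_def)
  ultimately have "card (children A (x, y)) = card S0 + card T0"
    unfolding eq by (simp add: card_Un_disjoint card_image inj_on_def)
  moreover have "S = {} \<longleftrightarrow> \<not> (\<exists>y'>y. (x, y') \<in> A)" "T = {} \<longleftrightarrow> \<not> (\<exists>x'>x. (x', y) \<in> A)"
    by (auto simp: S_def T_def)
  ultimately show ?thesis using card by simp
qed

text \<open>This puts condition (3), that no row or column is skipped, in the form used for
  \<open>trees\<close>.\<close>

lemma initial_segment:
  fixes S :: "nat set"
  assumes "finite S"
  shows "(\<forall>x\<in>S. \<forall>x'<x. x' \<in> S) \<longleftrightarrow> S = {..<card S}"
proof
  assume down: "\<forall>x\<in>S. \<forall>x'<x. x' \<in> S"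
  show "S = {..<card S}"
  proof (cases "S = {}")
    case False
    have "S = {..Max S}"
    proof (intro equalityI subsetI)
      fix x assume "x \<in> {..Max S}"
      then show "x \<in> S" using down Max_in[OF assms False] by (cases "x = Max S") auto
    qed (use assms in auto)
    then show ?thesis by (metis card_atMost lessThan_Suc_atMost)
  qed simp
next
  assume "S = {..<card S}"
  then show "\<forall>x\<in>S. \<forall>x'<x. x' \<in> S" by (metis lessThan_iff less_trans)
qed

lemma complete_non_ambiguous_tree_iff:
  "complete_non_ambiguous_tree A \<longleftrightarrow> complete_tree 0 0 A \<and>
     Domain A = {..<card (Domain A)} \<and> Range A = {..<card (Range A)}"
proof -
  have 1: "card (children A (x, y)) = 0 \<or> card (children A (x, y)) = 2 \<longleftrightarrow>
    (\<exists>y'>y. (x, y') \<in> A) = (\<exists>x'>x. (x', y) \<in> A)" if "(x, y) \<in> A" for x y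
    using card_children[OF that] by auto
  have seg: "(\<forall>p\<in>A. \<forall>x'<f p. \<exists>q\<in>A. f q = x') \<longleftrightarrow> f ` A = {..<card (f ` A)}"
    if "finite A" for f :: "_ \<Rightarrow> nat"
    using initial_segment[of "f ` A"] that by (simp add: image_iff) metis
  have 4: "(\<exists>q\<in>A. fst q = x \<and> snd q < y) \<longleftrightarrow> (\<exists>y'<y. (x, y') \<in> A)"
    "(\<exists>q\<in>A. snd q = y \<and> fst q < x) \<longleftrightarrow> (\<exists>x'<x. (x', y) \<in> A)" for x y
    by (auto simp: Bex_def split_paired_Ex)
  have 5: "(\<forall>p\<in>A. p \<noteq> (0, 0) \<longrightarrow>
      (\<exists>q\<in>A. fst q = fst p \<and> snd q < snd p) \<noteq> (\<exists>r\<in>A. snd r = snd p \<and> fst r < fst p))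
    \<longleftrightarrow> (\<forall>x y. (x, y) \<in> A \<longrightarrow> (x, y) \<noteq> (0, 0) \<longrightarrow> (\<exists>y'<y. (x, y') \<in> A) \<noteq> (\<exists>x'<x. (x', y) \<in> A))"
    by (simp only: Ball_def split_paired_All fst_conv snd_conv 4)
  have 6: "(\<forall>q\<in>A. card (children A q) = 0 \<or> card (children A q) = 2)
    \<longleftrightarrow> (\<forall>x y. (x, y) \<in> A \<longrightarrow> (\<exists>y'>y. (x, y') \<in> A) = (\<exists>x'>x. (x', y) \<in> A))"
    by (simp add: Ball_def split_paired_All 1 cong: imp_cong)
  show ?thesis
  proof (cases "finite A")
    case True
    show ?thesis
      unfolding complete_non_ambiguous_tree_def non_ambiguous_tree_def complete_tree_def 5 6
      by (simp only: seg[OF True] Domain_fst Range_snd le0 simp_thms conj_ac)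
  next
    case False
    then show ?thesis
      by (simp add: complete_non_ambiguous_tree_def non_ambiguous_tree_def complete_tree_def)
  qed
qed

lemma internal_vertices_eq:
  assumes "complete_tree a b A"
  shows "internal_vertices A = inner_vertices A"
proof -
  have "card (children A (x, y)) = 2 \<longleftrightarrow> (\<exists>y'>y. (x, y') \<in> A)" if "(x, y) \<in> A" for x y
    unfolding card_children[OF that] using complete_treeD(6)[OF assms that] by simp
  then show ?thesis
    unfolding internal_vertices_def inner_vertices_def by fastforce
qed

text \<open>Having \<open>k\<close> internal vertices amounts to having \<open>k + 1\<close> rows
  and columns.\<close>

lemma num_complete_nats_eq: "num_complete_nats k = num_trees (Suc k)"
proof -
  have Min: "Min {..<Suc k} = 0" by (rule Min_eqI) auto
  have "complete_non_ambiguous_tree A \<and> card (internal_vertices A) = k \<longleftrightarrow> A \<in> trees {..<Suc k} {..<Suc k}"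
    (is "?l \<longleftrightarrow> ?r") for A
  proof
    assume ?l
    then show ?r using card_Domain_Range[of 0 0 A] Min
      by (auto simp: complete_non_ambiguous_tree_iff trees_def internal_vertices_eq)
  next
    assume r: ?r
    then have t: "complete_tree 0 0 A" "Domain A = {..<Suc k}" "Range A = {..<Suc k}"
      using Min by (auto simp: trees_def)
    then show ?l using card_Domain_Range[OF t(1)]
      by (simp add: complete_non_ambiguous_tree_iff internal_vertices_eq[OF t(1)])
  qed
  then show ?thesis by (simp add: num_complete_nats_def num_trees_def)
qed

section \<open>The differential equation\<close>

definition euler_op :: "real fps \<Rightarrow> real fps" where
  "euler_op f = fps_X * fps_deriv f"

lemma euler_op_nth: "fps_nth (euler_op f) n = of_nat n * fps_nth f n"
  by (cases n) (simp_all add: euler_op_def)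

lemma euler_op_uminus: "euler_op (- f) = - euler_op f"
  by (simp add: euler_op_def)

text \<open>This is Bessel's equation of order 0, checked coefficientwise.\<close>

lemma euler_op_J0: "euler_op (euler_op fps_J0) = - (fps_X ^ 2 * fps_J0)"
proof (rule fps_ext)
  fix n
  show "fps_nth (euler_op (euler_op fps_J0)) n = fps_nth (- (fps_X ^ 2 * fps_J0)) n"
  proof (cases "n < 2")
    case True
    then have "n = 0 \<or> n = 1" by linarith
    then show ?thesis by (auto simp: euler_op_nth fps_X_power_mult_nth fps_J0_def)
  next
    case False
    then obtain m where m: "n = Suc (Suc m)" by (metis Suc_1 add_2_eq_Suc le_Suc_ex not_less)
    show ?thesis
    proof (cases "even m")
      case True
      then obtain k where k: "m = 2 * k" by blast
      \<comment> \<open>Consecutive nonzero coefficients of \<open>fps_J0\<close> have ratio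
        \<open>- 1 / (2 * k + 2)\<^sup>2\<close>.\<close>
      have "(2 * real k + 2)\<^sup>2 * ((- 1) ^ Suc k / (fact (Suc k))\<^sup>2 * (1 / 2) ^ (2 * k + 2))
        = - ((- 1) ^ k / (fact k)\<^sup>2 * (1 / 2) ^ (2 * k))"
        by (simp add: divide_simps power2_eq_square) (simp add: algebra_simps)
      then show ?thesis
        by (simp add: euler_op_nth fps_X_power_mult_nth fps_J0_def m k power2_eq_square algebra_simps)
    next
      case False
      then show ?thesis by (simp add: euler_op_nth fps_X_power_mult_nth fps_J0_def m)
    qed
  qed
qed

text \<open>By the chain rule the logarithmic derivative appears, since
  \<open>inverse (1 + fps_X) oo (f - 1)\<close> is the reciprocal of \<open>f\<close>. Multiplying
  by \<open>f\<close> avoids the quotient.\<close>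

lemma euler_op_log:
  assumes "fps_nth f 0 = 1"
  shows "f * euler_op (fps_log f) = euler_op f"
proof -
  have 0: "fps_nth (f - 1) 0 = 0" using assms by simp
  have "(inverse (1 + fps_X) oo (f - 1)) * ((1 + fps_X) oo (f - 1)) = 1"
    by (subst fps_compose_mult_distrib[OF 0, symmetric]) (simp add: inverse_mult_eq_1)
  then have "(inverse (1 + fps_X) oo (f - 1)) * f = 1"
    using 0 by (simp add: fps_compose_add_distrib)
  moreover have "fps_deriv (fps_log f) = (inverse (1 + fps_X) oo (f - 1)) * fps_deriv f"
    unfolding fps_log_def by (subst fps_compose_deriv[OF 0]) (simp add: fps_ln_deriv)
  ultimately show ?thesis by (simp add: euler_op_def algebra_simps)
qed

lemma euler_op_mult: "euler_op (f * g) = euler_op f * g + f * euler_op g"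
  by (simp add: euler_op_def algebra_simps)

text \<open>Apply \<theta> to \<open>?J * ?P = - euler_op ?J\<close>, insert Bessel's equation,
  replace \<open>euler_op ?J\<close> by \<open>- (?J * ?P)\<close> and cancel
  \<open>?J\<close>.\<close>

lemma euler_op_log_J0:
  defines "M \<equiv> - fps_log fps_J0"
  shows "euler_op (euler_op M) = fps_X ^ 2 + (euler_op M)\<^sup>2"
proof -
  let ?J = fps_J0 and ?P = "euler_op M"
  have J0: "fps_nth ?J 0 = 1" by (simp add: fps_J0_def)
  have "euler_op M = - euler_op (fps_log ?J)" by (simp add: M_def euler_op_uminus)
  then have P: "?J * ?P = - euler_op ?J" using euler_op_log[OF J0] by simp
  have "euler_op (?J * ?P) = fps_X ^ 2 * ?J"
    unfolding P euler_op_uminus euler_op_J0 by simp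
  then have "?J * euler_op ?P = fps_X ^ 2 * ?J - euler_op ?J * ?P"
    by (simp add: euler_op_mult algebra_simps)
  also have "euler_op ?J = - (?J * ?P)" using P by simp
  finally have "?J * euler_op ?P = ?J * (fps_X ^ 2 + ?P\<^sup>2)"
    by (simp add: power2_eq_square algebra_simps)
  moreover have "?J \<noteq> 0" using J0 by auto
  ultimately show ?thesis by simp
qed

lemma euler_op_eq_unique:
  assumes f: "euler_op (euler_op f) = h + (euler_op f)\<^sup>2"
    and g: "euler_op (euler_op g) = h + (euler_op g)\<^sup>2"
    and 0: "fps_nth f 0 = fps_nth g 0"
  shows "f = g"
proof (rule fps_ext)
  fix n show "fps_nth f n = fps_nth g n"
  proof (induction n rule: less_induct)
    case (less n)
    show ?case
    proof (cases "n = 0")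
      case False
      have rec: "(real n)\<^sup>2 * fps_nth u n = fps_nth h n +
        (\<Sum>i=0..n. (real i * fps_nth u i) * (real (n - i) * fps_nth u (n - i)))"
        if "euler_op (euler_op u) = h + (euler_op u)\<^sup>2" for u
        using arg_cong[OF that, of "\<lambda>s. fps_nth s n"]
        by (simp add: euler_op_nth power2_eq_square fps_mult_nth mult.assoc)
      have "(\<Sum>i=0..n. (real i * fps_nth f i) * (real (n - i) * fps_nth f (n - i))) =
        (\<Sum>i=0..n. (real i * fps_nth g i) * (real (n - i) * fps_nth g (n - i)))"
      proof (rule sum.cong[OF refl])
        fix i assume i: "i \<in> {0..n}"
        \<comment> \<open>The end terms vanish through the factors \<open>real i\<close> and
          \<open>real (n - i)\<close>, so only coefficients below \<open>n\<close> enter.\<close>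
        consider "i = 0" | "i = n" | "0 < i" "i < n" using i by fastforce
        then show "(real i * fps_nth f i) * (real (n - i) * fps_nth f (n - i)) =
          (real i * fps_nth g i) * (real (n - i) * fps_nth g (n - i))"
          by cases (simp_all add: less)
      qed
      then have "(real n)\<^sup>2 * fps_nth f n = (real n)\<^sup>2 * fps_nth g n"
        using rec[OF f] rec[OF g] by simp
      then show ?thesis using False by simp
    qed (simp add: 0)
  qed
qed

text \<open>Convergence of formal series is coefficientwise: coefficient \<open>n\<close> of the
  partial sums is constant once \<open>N > n\<close>.\<close>

lemma sums_even_fps:
  fixes c :: "nat \<Rightarrow> 'a::comm_ring_1"
  shows "(\<lambda>k. fps_const (c k) * fps_X ^ (2 * (k + 1))) sums
    Abs_fps (\<lambda>n. if even n \<and> n > 0 then c (n div 2 - 1) else 0)" (is "?f sums ?F")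
proof -
  have f: "fps_nth (?f k) n = (if n = 2 * (k + 1) then fps_nth ?F n else 0)" for k n
    by (auto simp: fps_X_power_nth)
  have s: "fps_nth (sum ?f {..<N}) n = fps_nth ?F n" if "n < N" for n N
  proof (cases "even n \<and> n > 0")
    case True
    then have m: "n = 2 * (n div 2)" "n div 2 > 0" by auto
    then have "n = 2 * (k + 1) \<longleftrightarrow> k = n div 2 - 1" for k by presburger
    then have "fps_nth (sum ?f {..<N}) n = (\<Sum>k<N. if k = n div 2 - 1 then fps_nth ?F n else 0)"
      by (simp only: fps_sum_nth f)
    also have "\<dots> = fps_nth ?F n" using that m by (subst sum.delta) auto
    finally show ?thesis .
  next
    case False
    then have "fps_nth (?f k) n = 0" for k unfolding f by auto
    then show ?thesis using False by (simp only: fps_sum_nth) auto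
  qed
  show ?thesis
    unfolding sums_def
    by (rule tendsto_fpsI, rule eventually_mono[OF eventually_gt_at_top]) (rule s)
qed

lemma sum_even_atMost:
  fixes g :: "nat \<Rightarrow> 'a::comm_monoid_add"
  assumes "\<And>i. odd i \<Longrightarrow> g i = 0"
  shows "(\<Sum>i\<le>2 * m. g i) = (\<Sum>i\<le>m. g (2 * i))"
  by (induction m) (use assms in simp_all)

text \<open>Writing the binomials with factorials turns the recursion into the convolution formula
  for the square of \<theta> \<open>G\<close>.\<close>

lemma euler_op_tree_series:
  fixes t :: "nat \<Rightarrow> nat"
  assumes t1: "t (Suc 0) = 1"
    and rec: "\<And>k. k > 0 \<Longrightarrow> t (Suc k) =
      (\<Sum>c<k. (k choose Suc c) * (k choose c) * t (Suc c) * t (k - c))"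
  defines "G \<equiv> Abs_fps (\<lambda>n. if even n \<and> n > 0 then
      real (t (Suc (n div 2 - 1))) / (fact (n div 2 - 1 + 1) * 2 ^ (n div 2 - 1 + 1))\<^sup>2 else 0)"
  shows "euler_op (euler_op G) = fps_X ^ 2 + (euler_op G)\<^sup>2"
proof (rule fps_ext)
  fix n
  define a where "a m = real (2 * m) * (real (t m) / (fact m * 2 ^ m)\<^sup>2)" for m
  have odd: "fps_nth (euler_op G) i = 0" if "odd i" for i
    using that by (auto simp: euler_op_nth G_def)
  have even: "fps_nth (euler_op G) (2 * m) = a m" for m
    by (cases m) (simp_all add: euler_op_nth G_def a_def)
  have sq: "fps_nth ((euler_op G)\<^sup>2) n = (\<Sum>i\<le>n. fps_nth (euler_op G) i * fps_nth (euler_op G) (n - i))"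
    by (simp add: power2_eq_square fps_mult_nth atMost_atLeast0)
  show "fps_nth (euler_op (euler_op G)) n = fps_nth (fps_X ^ 2 + (euler_op G)\<^sup>2) n"
  proof (cases "even n")
    case False
    have "fps_nth ((euler_op G)\<^sup>2) n = 0"
      unfolding sq
    proof (intro sum.neutral ballI)
      fix i assume "i \<in> {..n}"
      then have "odd i \<or> odd (n - i)" using False by simp
      then show "fps_nth (euler_op G) i * fps_nth (euler_op G) (n - i) = 0"
        using odd by (metis mult_zero_left mult_zero_right)
    qed
    then show ?thesis using False odd by (auto simp: euler_op_nth[of "euler_op G"] fps_X_power_nth)
  next
    case True
    then obtain m where n: "n = 2 * m" by blast
    have "fps_nth ((euler_op G)\<^sup>2) n = (\<Sum>i\<le>m. a i * a (m - i))"
      unfolding n sq[unfolded n] by (subst sum_even_atMost) (simp_all add: odd even flip: even right_diff_distrib')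
    \<comment> \<open>The 1 at \<open>m = 1\<close> is the coefficient of \<open>fps_X ^ 2\<close>
      and comes from \<open>t1\<close>.\<close>
    moreover have "real (2 * m) * a m = (if m = 1 then 1 else 0) + (\<Sum>i\<le>m. a i * a (m - i))"
    proof (cases "m \<le> 1")
      case True
      then have "m = 0 \<or> m = 1" by linarith
      then show ?thesis using t1 by (auto simp: a_def power2_eq_square)
    next
      case False
      then obtain k where k: "m = Suc k" "k > 0" by (cases m) auto
      \<comment> \<open>The factor \<open>real (2 * m)\<close> reduces \<open>fact m\<close> to
        \<open>fact k\<close>, which cancels against the numerators of the binomials.\<close>
      have s: "a (Suc c) * a (k - c) =
          real (2 * m) * real (2 * m) / (fact m * 2 ^ m)\<^sup>2 *
          real ((k choose Suc c) * (k choose c) * t (Suc c) * t (k - c))" if "c < k" for c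
      proof -
        define d where "d = k - Suc c"
        have d: "k = Suc (c + d)" and kc: "k - c = Suc d" using that by (simp_all add: d_def)
        have b: "real (k choose Suc c) = fact k / (fact (Suc c) * fact d)"
          "real (k choose c) = fact k / (fact c * fact (Suc d))"
          using binomial_fact[OF Suc_leI[OF that]] binomial_fact[OF less_imp_le[OF that]] kc
          by (simp_all only: d_def)
        show ?thesis
          unfolding a_def of_nat_mult b
          by (simp add: k(1) d power2_eq_square power_add divide_simps)
             (simp add: algebra_simps)
      qed
      \<comment> \<open>The terms \<open>i = 0\<close> and \<open>i = m\<close> vanish because
        \<open>a 0 = 0\<close>; the others are shifted by one.\<close>
      have "(\<Sum>i\<le>m. a i * a (m - i)) = (\<Sum>c<k. a (Suc c) * a (k - c))"
        unfolding k(1) sum.atMost_Suc_shift by (simp add: lessThan_Suc_atMost[symmetric] a_def[of 0] k)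
      also have "\<dots> = real (2 * m) * real (2 * m) / (fact m * 2 ^ m)\<^sup>2 * real (t (Suc k))"
        unfolding rec[OF k(2)] of_nat_sum sum_distrib_left by (rule sum.cong) (auto simp: s)
      finally show ?thesis using k by (simp add: a_def)
    qed
    ultimately show ?thesis
      by (auto simp: euler_op_nth[of "euler_op G"] fps_X_power_nth n even)
  qed
qed

theorem corollary10:
  "(\<lambda>k. fps_const (real (num_complete_nats k) / (fact (k + 1) * 2 ^ (k + 1))\<^sup>2)
        * fps_X ^ (2 * (k + 1)))
     sums (- fps_log fps_J0)"
proof -
  \<comment> \<open>The differential equation does not see the constant coefficient, so it is
    compared separately.\<close>
  have "fps_nth (- fps_log fps_J0) 0 = 0"
    by (simp add: fps_log_def fps_compose_nth)
  then have "Abs_fps (\<lambda>n. if even n \<and> n > 0 then real (num_trees (Suc (n div 2 - 1))) /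
      (fact (n div 2 - 1 + 1) * 2 ^ (n div 2 - 1 + 1))\<^sup>2 else 0) = - fps_log fps_J0"
    by (intro euler_op_eq_unique[OF euler_op_tree_series[OF num_trees_1 num_trees_rec] euler_op_log_J0])
       simp_all
  then show ?thesis
    unfolding num_complete_nats_eq
    using sums_even_fps[of "\<lambda>k. real (num_trees (Suc k)) / (fact (k + 1) * 2 ^ (k + 1))\<^sup>2"] by simp
qed

end
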